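(* Let $m\ge 3$ and $n\ge\lceil\sqrt[3]{2}\cdot m^{4/3}+m\rceil$ be integers. Then the complex zeros of $f_{m,n}(z)=\sum_{j=0}^{n}\binom{n}{j}z^{\binom{j}{m}}$ lie outside the circle centered at the origin with radius $m/(n-m+1)$, i.e., every zero satisfies $|z|>m/(n-m+1)$.
   Context: Conventions: $\binom{j}{m}=0$ for $0\le j<m$, and $z^0=1$. *)

theory Defs
  imports Complex_Main
begin

definition binom_sum_poly :: "nat \<Rightarrow> nat \<Rightarrow> complex \<Rightarrow> complex" where
  "binom_sum_poly m n z = (\<Sum>j=0..n. of_nat (n choose j) * z ^ (j choose m))"

end

theory Submission
  imports Defs
begin

text \<open>
  The hypothesis gives \<open>n \<ge> 3 * m\<close>, and this is all that is used. Let \<open>r = m / (n - m + 1)\<close>.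
  Consecutive binomial coefficients from index \<open>m - 1\<close> on grow at most by the factor \<open>1 / r\<close>,
  so for \<open>cmod z \<le> r\<close> the linear term is at most \<open>n choose (m - 1)\<close>, and the term of index \<open>m + k\<close> is at
  most \<open>(n choose (m - 1)) * r ^ (2 * k)\<close> because \<open>(m + k) choose m \<ge> 3 * k + 1\<close>. A geometric
  series shows that the terms of index \<open>> m\<close> together are smaller than \<open>n choose (m - 2)\<close>.
  Hence the constant coefficient dominates, and \<open>z\<close> is not a zero.
\<close>

text \<open>By Pascal's rule, for positive \<open>m\<close>, each increment of \<open>k\<close> adds
  a binomial coefficient that is at least \<open>m choose (m - 1)\<close>, which is
  \<open>m\<close>.\<close>

lemma choose_add_ge: "m * k + 1 \<le> (m + k) choose m"
proof (cases m)
  case (Suc p)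
  show ?thesis
  proof (induction k)
    case (Suc k)
    have "Suc p choose p \<le> (m + k) choose p"
      by (rule binomial_right_mono) (simp add: \<open>m = Suc p\<close>)
    with Suc.IH show ?case by (simp add: \<open>m = Suc p\<close>)
  qed simp
qed simp

text \<open>The ratio of consecutive coefficients is \<open>(n - j) / (j + 1)\<close>, which
  decreases in \<open>j\<close> and equals \<open>(n - m + 1) / m\<close> at
  \<open>j = m - 1\<close>.\<close>

lemma choose_Suc_mult_le:
  assumes "m \<le> Suc j" "m \<le> n"
  shows "real (n choose Suc j) * (real m / (real n - real m + 1)) \<le> real (n choose j)"
proof (cases "j < n")
  case True
  have "Suc j * (n choose Suc j) = (n - j) * (n choose j)"
    by (metis binomial_absorption binomial_absorb_comp)
  then have "real (Suc j) * real (n choose Suc j) = (real n - real j) * real (n choose j)"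
    using True by (metis less_imp_le of_nat_diff of_nat_mult)
  moreover have "real m * real (n choose Suc j) \<le> real (Suc j) * real (n choose Suc j)"
    using assms by (intro mult_right_mono) auto
  moreover have "(real n - real j) * real (n choose j) \<le> (real n - real m + 1) * real (n choose j)"
    using assms by (intro mult_right_mono) auto
  ultimately show ?thesis
    using assms by (simp add: field_simps)
qed (simp add: not_less binomial_eq_0)

lemma choose_add_mult_power_le:
  assumes "0 < m" "m \<le> n"
  shows "real (n choose (m - 1 + i)) * (real m / (real n - real m + 1)) ^ i \<le> real (n choose (m - 1))"
proof (induction i)
  case (Suc i)
  let ?r = "real m / (real n - real m + 1)"
  have "real (n choose Suc (m - 1 + i)) * ?r * ?r ^ i \<le> real (n choose (m - 1 + i)) * ?r ^ i"
    using assms by (intro mult_right_mono choose_Suc_mult_le) auto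
  with Suc show ?case by (simp add: mult_ac)
qed simp

lemma sum_power_le_geometric:
  fixes x :: real
  assumes "0 \<le> x" "x < 1"
  shows "(\<Sum>k=1..N. x ^ k) \<le> x / (1 - x)"
  using assms by (simp add: sum_gp divide_right_mono)

text \<open>For \<open>N = n - m + 1\<close> the right side is the ratio of
  \<open>n choose (m - 2)\<close> to \<open>n choose (m - 1)\<close>. With denominators cleared, the
  claim is checked at \<open>N = 2 * m + 1\<close> and carried to larger \<open>N\<close> by
  comparing growth.\<close>

lemma geometric_bound_less:
  fixes m N :: real
  assumes "3 \<le> m" "2 * m + 1 \<le> N"
  shows "(m / N)\<^sup>2 / (1 - (m / N)\<^sup>2) < (m - 1) / (N + 1)"
proof -
  \<comment> \<open>This is the difference of the two sides of \<open>base\<close>, arranged in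
    powers of \<open>m\<close> times \<open>m - 3\<close> so that its sign is visible.\<close>
  have "0 < (m - 3) * (m * m) + 2 * ((m - 3) * m) + 3 * (m - 3) + 8"
    using assms by (intro add_nonneg_pos add_nonneg_nonneg mult_nonneg_nonneg) auto
  then have base: "m\<^sup>2 * (2 * m + 2) < (m - 1) * ((2 * m + 1)\<^sup>2 - m\<^sup>2)"
    by (simp add: power2_eq_square algebra_simps)
  have "m * m \<le> (m - 1) * (N + (2 * m + 1))"
  proof -
    have "m * m \<le> (m - 1) * (4 * m)"
      using mult_right_mono[of 3 m m] assms by (simp add: algebra_simps)
    also have "\<dots> \<le> (m - 1) * (N + (2 * m + 1))"
      using assms by (intro mult_left_mono) auto
    finally show ?thesis .
  qed
  then have "m * m * (N - (2 * m + 1)) \<le> (m - 1) * (N + (2 * m + 1)) * (N - (2 * m + 1))"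
    using assms by (intro mult_right_mono) auto
  with base have key: "m\<^sup>2 * (N + 1) < (m - 1) * (N\<^sup>2 - m\<^sup>2)"
    by (simp add: power2_eq_square algebra_simps)
  have "m\<^sup>2 < N\<^sup>2" using assms by (intro power_strict_mono) auto
  moreover have "(m / N)\<^sup>2 / (1 - (m / N)\<^sup>2) = m\<^sup>2 / (N\<^sup>2 - m\<^sup>2)"
    using assms by (simp add: field_simps)
  ultimately show ?thesis
    using key assms by (simp add: frac_less_eq divide_less_eq less_divide_eq field_simps)
qed

lemma three_mult_le:
  assumes "3 \<le> m" and "int n \<ge> \<lceil>root 3 2 * real m powr (4 / 3) + real m\<rceil>"
  shows "3 * m \<le> n"
proof -
  have "real m powr (4 / 3) = real m powr 1 * real m powr (1 / 3)"
    using assms(1) by (subst powr_add[symmetric]) simp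
  then have eq: "root 3 2 * real m powr (4 / 3) = root 3 (2 * real m) * real m"
    using assms(1) by (simp add: root_powr_inverse powr_mult mult_ac)
  have n: "root 3 (2 * real m) * real m + real m \<le> real n"
    using assms(2) unfolding eq ceiling_le_iff by simp
  \<comment> \<open>Needed for \<open>m = 3\<close>, where the cube root of 6 is below 2: the bound
    5/3 gives \<open>n > 8\<close>, and integrality gives \<open>n \<ge> 9\<close>.\<close>
  have "(5 / 3) ^ 3 < 2 * real m" using assms(1) by (simp add: power3_eq_cube)
  then have "5 / 3 < root 3 (2 * real m)"
    by (metis real_root_less_iff real_root_power_cancel zero_less_numeral divide_nonneg_pos zero_le_numeral)
  show ?thesis
  proof (cases "m = 3")
    case True
    with \<open>5 / 3 < root 3 (2 * real m)\<close> n show ?thesis by simp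
  next
    case False
    then have "2 ^ 3 \<le> 2 * real m" using assms(1) by simp
    then have "2 \<le> root 3 (2 * real m)"
      by (metis real_root_le_iff real_root_power_cancel zero_less_numeral zero_le_numeral)
    then have "2 * real m \<le> root 3 (2 * real m) * real m" by (intro mult_right_mono) auto
    with n show ?thesis by linarith
  qed
qed

lemma binom_sum_poly_eq_0_imp_norm_gt:
  assumes "3 \<le> m" "3 * m \<le> n" "binom_sum_poly m n z = 0"
  shows "real m / (real n - real m + 1) < cmod z"
proof (rule ccontr)
  define r where "r = real m / (real n - real m + 1)"
  define C where "C = real (n choose (m - 1))"
  assume "\<not> ?thesis"
  then have z: "cmod z \<le> r" by (simp add: r_def)
  have r: "0 < r" "r < 1" using assms by (auto simp: r_def field_simps)
  then have r2: "r\<^sup>2 < 1" by (simp add: power_less_one_iff)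
  have C: "0 < C" using assms by (simp add: C_def)
  have linear: "real (n choose m) * cmod z \<le> C"
  proof -
    have "real (n choose m) * cmod z \<le> real (n choose m) * r"
      using z by (intro mult_left_mono) auto
    also have "\<dots> \<le> C"
      using choose_add_mult_power_le[of m n 1] assms by (simp add: C_def r_def)
    finally show ?thesis .
  qed
  have higher: "real (n choose (m + k)) * cmod z ^ ((m + k) choose m) \<le> C * (r\<^sup>2) ^ k" for k
  proof -
    have "3 * k + 1 \<le> (m + k) choose m"
      using choose_add_ge[of m k] mult_right_mono[OF assms(1), of k] by linarith
    \<comment> \<open>The exponent \<open>3 * k + 1\<close> is split: \<open>k + 1\<close> factors
      \<open>r\<close> bring the coefficient down to \<open>C\<close>, and \<open>2 * k\<close>
      remain for the geometric series.\<close>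
    then have "cmod z ^ ((m + k) choose m) \<le> r ^ (k + 1 + 2 * k)"
      using z r by (intro order_trans[OF power_mono[OF z] power_decreasing]) auto
    then have "real (n choose (m + k)) * cmod z ^ ((m + k) choose m)
        \<le> real (n choose (m + k)) * r ^ (k + 1) * r ^ (2 * k)"
      unfolding mult.assoc power_add[symmetric] by (intro mult_left_mono) auto
    also have "\<dots> \<le> C * r ^ (2 * k)"
      using choose_add_mult_power_le[of m n "k + 1"] assms r
      by (intro mult_right_mono) (auto simp: C_def r_def)
    finally show ?thesis by (simp add: power_mult)
  qed
  define tail where "tail = (\<Sum>k=1..n-m. of_nat (n choose (m + k)) * z ^ ((m + k) choose m))"
  have "cmod tail \<le> (\<Sum>k=1..n-m. C * (r\<^sup>2) ^ k)"
    unfolding tail_def by (intro sum_norm_le) (simp add: norm_mult norm_power higher)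
  also have "\<dots> \<le> C * (r\<^sup>2 / (1 - r\<^sup>2))"
    unfolding sum_distrib_left[symmetric]
    using C r r2 by (intro mult_left_mono sum_power_le_geometric) auto
  \<comment> \<open>Here \<open>3 * m \<le> n\<close> enters as
    \<open>2 * m + 1 \<le> n - m + 1\<close>.\<close>
  also have "\<dots> < C * ((real m - 1) / ((real n - real m + 1) + 1))"
    unfolding r_def using assms C
    by (intro mult_strict_left_mono geometric_bound_less) auto
  also have "\<dots> = real (n choose (m - 2))"
  proof -
    have "Suc (m - 2) * (n choose Suc (m - 2)) = (n - (m - 2)) * (n choose (m - 2))"
      by (metis binomial_absorption binomial_absorb_comp)
    moreover have "Suc (m - 2) = m - 1" using assms by simp
    ultimately have "(m - 1) * (n choose (m - 1)) = (n - (m - 2)) * (n choose (m - 2))" by simp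
    then have "real (m - 1) * C = real (n - (m - 2)) * real (n choose (m - 2))"
      unfolding C_def of_nat_mult[symmetric] by simp
    then show ?thesis using assms by (simp add: of_nat_diff field_simps)
  qed
  finally have tail: "cmod tail < real (n choose (m - 2))" .
  have "binom_sum_poly m n z = (\<Sum>j\<in>{..<m}. of_nat (n choose j)) + (of_nat (n choose m) * z + tail)"
  proof -
    have "{0..n} = {..<m} \<union> {m..n}" using assms by auto
    then have "binom_sum_poly m n z = (\<Sum>j\<in>{..<m}. of_nat (n choose j) * z ^ (j choose m))
        + (\<Sum>j=m..n. of_nat (n choose j) * z ^ (j choose m))"
      unfolding binom_sum_poly_def by (simp only: \<open>{0..n} = _\<close>) (rule sum.union_disjoint, auto)
    \<comment> \<open>For \<open>j < m\<close> the exponent \<open>j choose m\<close> is 0, so these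
      terms form the constant coefficient.\<close>
    also have "(\<Sum>j\<in>{..<m}. of_nat (n choose j) * z ^ (j choose m)) = (\<Sum>j\<in>{..<m}. of_nat (n choose j))"
      by (intro sum.cong) (auto simp: binomial_eq_0)
    also have "(\<Sum>j=m..n. of_nat (n choose j) * z ^ (j choose m))
        = (\<Sum>k=0..n-m. of_nat (n choose (m + k)) * z ^ ((m + k) choose m))"
      using sum.shift_bounds_cl_nat_ivl[of _ 0 m "n - m"] assms by (simp add: add.commute)
    also have "\<dots> = of_nat (n choose m) * z + tail"
      unfolding tail_def by (subst sum.atLeast_Suc_atMost) auto
    finally show ?thesis .
  qed
  then have "of_real (\<Sum>j\<in>{..<m}. real (n choose j)) = - (of_nat (n choose m) * z + tail)"
    using assms(3) by (simp only: eq_neg_iff_add_eq_0) simp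
  then have "(\<Sum>j\<in>{..<m}. real (n choose j)) \<le> cmod (of_nat (n choose m) * z + tail)"
    by (metis norm_minus_cancel norm_of_real abs_ge_self)
  also have "\<dots> \<le> real (n choose m) * cmod z + cmod tail"
    by (intro order_trans[OF norm_triangle_ineq]) (simp add: norm_mult)
  also have "\<dots> < C + real (n choose (m - 2))" using linear tail by simp
  \<comment> \<open>The bounds for the linear term and the tail are two distinct summands of the
    constant coefficient.\<close>
  also have "\<dots> = (\<Sum>j\<in>{m - 1, m - 2}. real (n choose j))"
    using assms by (simp add: C_def)
  also have "\<dots> \<le> (\<Sum>j\<in>{..<m}. real (n choose j))"
    using assms by (intro sum_mono2) auto
  finally show False by simp
qed

theorem corollary5p4:
  fixes m n :: nat and z :: complex
  assumes "m \<ge> 3"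
    and "int n \<ge> \<lceil>root 3 2 * real m powr (4 / 3) + real m\<rceil>"
    and "binom_sum_poly m n z = 0"
  shows "cmod z > real m / (real n - real m + 1)"
  using assms three_mult_le binom_sum_poly_eq_0_imp_norm_gt by blast

end
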